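(* Let $n\ge 2$ be an integer and let $k=k(n)$ be the integer defined by $\sigma_k\le n<\sigma_{k+1}$. For every integer $j$ satisfying $1\le j\le k$ we have $$h_{j-1}(n)\le \frac56\, h_j(n),$$ and this inequality is an equality if and only if $j=k(n)\ge 2$ and ($n=\sigma_{j+1}-4$ or $n=\sigma_{j+1}-5$).
   Context: Let $p_i$ denote the $i$-th prime ($p_1=2$). Set $\sigma_0=0$ and $\sigma_j=p_1+p_2+\dots+p_j$ for $j\ge1$. For a squarefree positive integer $M$, $\ell(M)$ denotes the sum of the prime factors of $M$ (with $\ell(1)=0$) and $\omega(M)$ the number of prime factors of $M$. For an integer $n\ge 0$, $k(n)$ is the unique non-negative integer $k$ with $\sigma_k\le n<\sigma_{k+1}$. For $0\le j\le k(n)$ (equivalently $n\ge\sigma_j$), $h_j(n)$ is the maximum of all squarefree positive integers $M$ with $\omega(M)=j$ and $\ell(M)\le n$; in particular $h_0(n)=1$. *)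

theory Defs
  imports
    Complex_Main
    "HOL-Library.Infinite_Set"
    "HOL-Computational_Algebra.Computational_Algebra"
begin

(* enumerate counts from 0, whereas the primes are indexed from 1; the value at 0 is never used. *)
definition nth_prime :: "nat \<Rightarrow> nat" where
  "nth_prime i = enumerate {p. prime p} (i - 1)"

definition sigma :: "nat \<Rightarrow> nat" where
  "sigma j = (\<Sum>i=1..j. nth_prime i)"

definition ell :: "nat \<Rightarrow> nat" where
  "ell M = (\<Sum>p\<in>prime_factors M. p)"

definition omega :: "nat \<Rightarrow> nat" where
  "omega M = card (prime_factors M)"

definition kmax :: "nat \<Rightarrow> nat" where
  "kmax n = (THE k. sigma k \<le> n \<and> n < sigma (k + 1))"

definition candidates :: "nat \<Rightarrow> nat \<Rightarrow> nat set" where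
  "candidates j n = {M. M > 0 \<and> squarefree M \<and> omega M = j \<and> ell M \<le> n}"

(* Only meaningful for sigma j <= n: otherwise candidates j n is empty. *)
definition h :: "nat \<Rightarrow> nat \<Rightarrow> nat" where
  "h j n = Max (candidates j n)"

lemma prime_nth_prime: "prime (nth_prime i)"
  using enumerate_in_set[OF primes_infinite, of "i - 1"] by (simp add: nth_prime_def)

lemma nth_prime_1: "nth_prime 1 = 2"
  unfolding nth_prime_def enumerate_0 diff_self_eq_0 mem_Collect_eq
  by (rule Least_equality) (auto dest: prime_ge_2_nat)

lemma nth_prime_Suc:
  assumes "i \<ge> 1"
  shows "nth_prime (Suc i) = (LEAST q. prime q \<and> nth_prime i < q)"
proof -
  obtain m where "i = Suc m" using assms by (cases i) auto
  then show ?thesis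
    using enumerate_Suc''[OF primes_infinite, of m] by (simp add: nth_prime_def)
qed

lemma inj_on_nth_prime: "inj_on nth_prime {1..j}"
proof (rule inj_onI)
  fix x y assume xy: "x \<in> {1..j}" "y \<in> {1..j}" "nth_prime x = nth_prime y"
  have "x - 1 = y - 1"
    using xy(3) enumerate_mono_iff[OF primes_infinite, of "x - 1" "y - 1"]
      enumerate_mono_iff[OF primes_infinite, of "y - 1" "x - 1"]
    unfolding nth_prime_def by (metis less_irrefl linorder_neqE_nat)
  then show "x = y" using xy by auto
qed

lemma sigma_Suc: "sigma (Suc j) = sigma j + nth_prime (Suc j)"
  by (simp add: sigma_def)

lemma strict_mono_sigma: "strict_mono sigma"
  unfolding strict_mono_Suc_iff
  using prime_nth_prime prime_gt_0_nat by (simp add: sigma_Suc)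

lemma kmax_ex1: "\<exists>!k. sigma k \<le> n \<and> n < sigma (k + 1)"
proof -
  have "n < sigma (Suc n)"
    using strict_mono_imp_increasing[OF strict_mono_sigma, of "Suc n"] by simp
  moreover have "\<not> n < sigma 0" by (simp add: sigma_def)
  ultimately obtain k where "\<not> n < sigma k" "n < sigma (Suc k)"
    using inc_induct[of 0 "Suc n" "\<lambda>k. n < sigma k"] by blast
  then have k: "sigma k \<le> n \<and> n < sigma (k + 1)" by simp
  show ?thesis
  proof (rule ex1I[of _ k])
    show "sigma k \<le> n \<and> n < sigma (k + 1)" by (fact k)
    fix k' assume k': "sigma k' \<le> n \<and> n < sigma (k' + 1)"
    have "k < k' + 1" "k' < k + 1"
      using k k' strict_mono_less[OF strict_mono_sigma] le_less_trans by blast+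
    then show "k' = k" by simp
  qed
qed

lemma kmax_spec: "sigma (kmax n) \<le> n" "n < sigma (kmax n + 1)"
  using theI'[OF kmax_ex1[of n]] by (auto simp: kmax_def)

lemma squarefree_prod_primes:
  fixes A :: "nat set"
  assumes "finite A" "\<And>p. p \<in> A \<Longrightarrow> prime p"
  shows "squarefree (\<Prod>A)" "prime_factors (\<Prod>A) = A"
proof -
  have "prime_factorization (\<Prod>A) = mset_set A"
  proof -
    have "prime_factorization (prod_mset (mset_set A)) = mset_set A"
      by (rule prime_factorization_prod_mset_primes) (use assms in auto)
    then show ?thesis by (simp add: prod_unfold_prod_mset)
  qed
  then show "prime_factors (\<Prod>A) = A" using assms by simp
  have "squarefree (\<Prod>p\<in>A. p)"
    by (rule squarefree_prod_coprime)
      (use assms in \<open>auto intro: squarefree_prime primes_coprime\<close>)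
  then show "squarefree (\<Prod>A)" by simp
qed

lemma finite_candidates: "finite (candidates j n)"
proof (rule finite_subset)
  show "candidates j n \<subseteq> Prod ` Pow {..n}"
  proof
    fix M assume "M \<in> candidates j n"
    then have M: "M > 0" "squarefree M" "ell M \<le> n" by (auto simp: candidates_def)
    have "M = (\<Prod>p\<in>prime_factors M. p ^ multiplicity p M)"
      using M(1) prime_factorization_nat by auto
    also have "\<dots> = \<Prod>(prime_factors M)"
      using squarefree_factorial_semiring'[of M] M by (intro prod.cong) auto
    finally have "M = \<Prod>(prime_factors M)" .
    moreover have "p \<le> n" if "p \<in> prime_factors M" for p
      using member_le_sum[of p "prime_factors M" "\<lambda>p. p"] that M(3) by (simp add: ell_def)
    ultimately show "M \<in> Prod ` Pow {..n}" by blast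
  qed
qed simp

lemma candidates_nonempty:
  assumes "sigma j \<le> n"
  shows "candidates j n \<noteq> {}"
proof -
  let ?A = "nth_prime ` {1..j}"
  have A: "finite ?A" "\<And>p. p \<in> ?A \<Longrightarrow> prime p" using prime_nth_prime by auto
  have sf: "squarefree (\<Prod>?A)" and pf: "prime_factors (\<Prod>?A) = ?A"
    using squarefree_prod_primes[of ?A] A by blast+
  have "omega (\<Prod>?A) = j"
    unfolding omega_def pf card_image[OF inj_on_nth_prime] by simp
  moreover have "ell (\<Prod>?A) = sigma j"
    unfolding ell_def sigma_def pf sum.reindex[OF inj_on_nth_prime]
    by simp
  moreover have "\<Prod>?A > 0"
    using A(2) prime_gt_0_nat by (simp add: prod_pos)
  ultimately have "\<Prod>?A \<in> candidates j n"
    using assms sf by (simp add: candidates_def)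
  then show ?thesis by blast
qed

lemma h_spec:
  assumes "sigma j \<le> n"
  shows "h j n \<in> candidates j n" "\<And>M. M \<in> candidates j n \<Longrightarrow> M \<le> h j n"
  using Max_in[OF finite_candidates candidates_nonempty[OF assms]] Max_ge[OF finite_candidates]
  by (auto simp: h_def)

end

(* Let A be an optimal (j - 1)-set of primes and p the least prime outside A. In A \<union> {p}, replace a
   prime q by the preceding prime r, whenever r is not yet in the set, until the sum is at most n. Such
   a q exists as long as the sum exceeds n, because the set is then not {p_1, ..., p_j}. All primes r
   used are at least p + 2 if p is odd, so the steps before the last one, which lower the sum by at
   most p - 1, cost a factor of at most exp ((p - 1) / (p + 2)), and the last one costs at most 5/3,
   because consecutive primes r < q with r \<ge> 5 satisfy 3 q < 5 r. In total this is less than 5 p / 6.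
   If p = 2 there is a single step, and equality forces q = 5 and r = 3 to be the only possible choice,
   that is A = {5, 7, ..., p_{j+1}}. Lowering a j-set together with its least missing prime all the way
   to {p_1, ..., p_{j+1}} gives the converse.

   The bound on prime gaps follows Chebyshev and Erdos, with (6m)! m! / ((3m)! (2m)!^2) in place of the
   central binomial coefficient. For N = 6m this quotient is about 108^(N/6) = (2.18...)^N and is
   bounded by primorial N up to a factor N^(sqrt N); as primorial n \<le> 12^(n/2), the absence of primes
   between 3N/5 and N would bound it by about 12^(3N/10) = (2.10...)^N. *)
theory Submission
  imports Defs
begin

section \<open>A Chebyshev quotient of factorials\<close>

text \<open>Legendre's formula. Terms with \<open>i > n\<close> vanish, so any
  \<open>K \<ge> n\<close> can serve as the cut-off; a common \<open>K\<close> lets all factorials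
  of a quotient be compared term by term.\<close>

lemma multiplicity_fact:
  fixes p :: nat
  assumes p: "prime p" and "n \<le> K"
  shows "multiplicity p (fact n) = (\<Sum>i=1..K. n div p ^ i)"
  using \<open>n \<le> K\<close>
proof (induction n)
  case 0
  then show ?case by simp
next
  case (Suc n)
  have "multiplicity p (fact (Suc n)) = multiplicity p (Suc n) + multiplicity p (fact n)"
    unfolding fact_Suc using p by (subst prime_elem_multiplicity_mult_distrib) auto
  moreover have "multiplicity p (Suc n) = (\<Sum>i=1..K. of_bool (p ^ i dvd Suc n))"
  proof -
    have "i \<le> K" if "p ^ i dvd Suc n" for i
      using dvd_imp_le[OF that] Suc.prems prime_gt_1_nat[OF p] less_exp[of i]
        power_mono[of 2 p i] by linarith
    then have "{i \<in> {1..K}. p ^ i dvd Suc n} = {1..multiplicity p (Suc n)}"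
      using p prime_gt_1_nat[OF p] by (auto simp: power_dvd_iff_le_multiplicity)
    then show ?thesis by (simp add: of_bool_def sum.If_cases Int_def)
  qed
  moreover have "Suc n div p ^ i = of_bool (p ^ i dvd Suc n) + n div p ^ i" for i
    by (simp add: div_Suc dvd_eq_mod_eq_0)
  ultimately show ?case using Suc by (simp add: sum.distrib)
qed

definition chebyshev_quot :: "nat \<Rightarrow> nat" where
  "chebyshev_quot m = fact (6 * m) * fact m div (fact (3 * m) * (fact (2 * m))\<^sup>2)"

text \<open>For t = floor (6m / p^i) this is what p^i contributes to the exponent of p in the
  quotient. Since 1 + 1/6 = 1/2 + 2/3, it depends only on t mod 6: it is 1 for the residues 1, 2, 5
  and 0 for the others.\<close>

definition chebyshev_weight :: "nat \<Rightarrow> nat" where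
  "chebyshev_weight t = t + t div 6 - (t div 2 + 2 * (t div 3))"

lemma chebyshev_weight:
  "t + t div 6 = t div 2 + 2 * (t div 3) + chebyshev_weight t" "chebyshev_weight t \<le> 1"
proof -
  obtain q r where t: "t = 6 * q + r" "r < 6"
    using mod_less_divisor[of 6 t] mult_div_mod_eq[of 6 t] by (metis zero_less_numeral)
  have "t div 6 = q" "t div 2 = 3 * q + r div 2" "t div 3 = 2 * q + r div 3"
    using t by auto
  moreover have "r \<in> {0, 1, 2, 3, 4, 5}" using t(2) by auto
  ultimately show "t + t div 6 = t div 2 + 2 * (t div 3) + chebyshev_weight t"
    and "chebyshev_weight t \<le> 1"
    by (auto simp: chebyshev_weight_def t)
qed

text \<open>Legendre's formula is applied to all factorials at once. As no weight is negative, the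
  denominator divides the numerator, so the \<open>div\<close> in \<open>chebyshev_quot\<close> is
  exact.\<close>

lemma
  shows chebyshev_quot: "chebyshev_quot m * (fact (3 * m) * (fact (2 * m))\<^sup>2) = fact (6 * m) * fact m"
    and multiplicity_chebyshev_quot:
      "prime p \<Longrightarrow> multiplicity p (chebyshev_quot m) = (\<Sum>i=1..6*m. chebyshev_weight (6 * m div p ^ i))"
proof -
  let ?N = "fact (6 * m) * fact m :: nat" and ?D = "fact (3 * m) * (fact (2 * m))\<^sup>2 :: nat"
  have mult: "multiplicity p ?N = multiplicity p ?D + (\<Sum>i=1..6*m. chebyshev_weight (6 * m div p ^ i))"
    if p: "prime p" for p
  proof -
    \<comment> \<open>Nested floors: every term becomes a function of the single number t = floor
      (6m / q).\<close>
    have d: "a * m div q = (b * a * m div q) div b" if "b > 0" for a b q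
    proof -
      have "(b * a * m div q) div b = (b * (a * m)) div (b * q)"
        by (simp only: div_mult2_eq[symmetric] ac_simps)
      then show ?thesis using that by simp
    qed
    have d: "3 * m div q = (6 * m div q) div 2" "2 * m div q = (6 * m div q) div 3"
      "m div q = (6 * m div q) div 6" for q
      using d[of 2 3] d[of 3 2] d[of 6 1] by simp_all
    have "multiplicity p ?N = (\<Sum>i=1..6*m. 6 * m div p ^ i + m div p ^ i)"
      using p by (subst prime_elem_multiplicity_mult_distrib)
        (auto simp: multiplicity_fact[where K = "6 * m"] sum.distrib)
    also have "\<dots> = (\<Sum>i=1..6*m. 3 * m div p ^ i + 2 * (2 * m div p ^ i) + chebyshev_weight (6 * m div p ^ i))"
      by (intro sum.cong refl) (simp only: d chebyshev_weight)
    also have "\<dots> = multiplicity p ?D + (\<Sum>i=1..6*m. chebyshev_weight (6 * m div p ^ i))"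
      using p by (subst prime_elem_multiplicity_mult_distrib)
        (auto simp: prime_elem_multiplicity_power_distrib multiplicity_fact[where K = "6 * m"]
          sum.distrib sum_distrib_left)
    finally show ?thesis .
  qed
  have "?D dvd ?N"
    by (rule multiplicity_le_imp_dvd) (auto simp: mult)
  then show *: "chebyshev_quot m * ?D = ?N"
    unfolding chebyshev_quot_def by simp
  then have "chebyshev_quot m \<noteq> 0" by (metis fact_nonzero mult_eq_0_iff)
  then have "multiplicity p ?N = multiplicity p (chebyshev_quot m) + multiplicity p ?D" if "prime p" for p
    unfolding *[symmetric] using that by (intro prime_elem_multiplicity_mult_distrib) auto
  then show "multiplicity p (chebyshev_quot m) = (\<Sum>i=1..6*m. chebyshev_weight (6 * m div p ^ i))"
    if "prime p"
    using mult[OF that] that by simp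
qed

lemma chebyshev_quot_pos: "chebyshev_quot m > 0"
  using chebyshev_quot[of m] by (metis fact_nonzero mult_eq_0_iff neq0_conv)

text \<open>The ratio of consecutive quotients in division-free form. It tends to 6 * 36 / 2 = 108,
  the source of this constant in both bounds below.\<close>

lemma chebyshev_quot_Suc:
  "chebyshev_quot (Suc m) * ((2 * m + 1) * (m + 1)) = 6 * (6 * m + 1) * (6 * m + 5) * chebyshev_quot m"
proof -
  let ?D = "fact (3 * m) * (fact (2 * m))\<^sup>2 :: nat"
  \<comment> \<open>The common factor of the two products of linear terms in
    \<open>c\<close>.\<close>
  define k where "k = 12 * (m + 1)\<^sup>2 * (2 * m + 1) * (3 * m + 1) * (3 * m + 2)"
  have fact: "fact (n + 2) = (n+2) * ((n+1) * (fact n :: nat))"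
    "fact (n + 3) = (n+3) * ((n+2) * ((n+1) * (fact n :: nat)))"
    "fact (n + 6) = (n+6) * ((n+5) * ((n+4) * ((n+3) * ((n+2) * ((n+1) * (fact n :: nat))))))" for n
    by (simp_all only: numeral_eq_Suc pred_numeral_simps BitM.simps One_nat_def
        add_Suc_right add_0_right fact_Suc of_nat_id)
  let ?c6 = "(6*m+6)*(6*m+5)*(6*m+4)*(6*m+3)*(6*m+2)*(6*m+1)"
  have f6: "fact (6 * Suc m) = ?c6 * (fact (6*m) :: nat)"
    using fact(3)[of "6 * m"] by (simp only: mult_Suc_right add.commute mult.assoc)
  have f3: "fact (3 * Suc m) = (3*m+3)*(3*m+2)*(3*m+1) * (fact (3*m) :: nat)"
    using fact(2)[of "3 * m"] by (simp only: mult_Suc_right add.commute mult.assoc)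
  have f2: "fact (2 * Suc m) = (2*m+2)*(2*m+1) * (fact (2*m) :: nat)"
    using fact(1)[of "2 * m"] by (simp only: mult_Suc_right add.commute mult.assoc)
  have f1: "fact (Suc m) = (m + 1) * (fact m :: nat)"
    by simp
  have e: "3*m+3 = 3*(m+1)" "2*m+2 = 2*(m+1)" "6*m+6 = 6*(m+1)" "6*m+4 = 2*(3*m+2)"
    "6*m+2 = 2*(3*m+1)" "6*m+3 = 3*(2*m+1)"
    by simp_all
  have "3*a*b*c*(2*a*d)\<^sup>2 = 12 * a\<^sup>2 * d * c * b * (d * a)"
    "6*a*f*(2*b)*(3*d)*(2*c)*g*a = 12 * a\<^sup>2 * d * c * b * (6 * g * f)" for a b c d f g :: nat
    by (simp_all add: power2_eq_square)
  then have c: "(3*m+3)*(3*m+2)*(3*m+1)*((2*m+2)*(2*m+1))^2 = k * ((2*m+1) * (m+1))"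
    "(6*m+6)*(6*m+5)*(6*m+4)*(6*m+3)*(6*m+2)*(6*m+1)*(m+1) = k * (6 * (6*m+1) * (6*m+5))"
    unfolding k_def e by this+
  have cancel: "(f3 * f2\<^sup>2) * (x * (a * b\<^sup>2)) = (f3 * f2\<^sup>2) * (c * d * y)"
    if "x * ((a * f3) * (b * f2)\<^sup>2) = (c * f6) * (d * f1)" "y * (f3 * f2\<^sup>2) = f6 * f1"
    for x a b c d y f1 f2 f3 f6 :: nat
  proof -
    have "(f3 * f2\<^sup>2) * (x * (a * b\<^sup>2)) = x * ((a * f3) * (b * f2)\<^sup>2)"
      by (simp add: power_mult_distrib)
    also have "\<dots> = c * d * (f6 * f1)" using that by simp
    also have "\<dots> = (f3 * f2\<^sup>2) * (c * d * y)" unfolding that(2)[symmetric] by simp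
    finally show ?thesis .
  qed
  have "?D * (chebyshev_quot (Suc m) * (k * ((2 * m + 1) * (m + 1))))
    = ?D * (k * (6 * (6 * m + 1) * (6 * m + 5)) * chebyshev_quot m)"
    using cancel[OF chebyshev_quot[of "Suc m", unfolded f6 f3 f2 f1] chebyshev_quot]
    unfolding c .
  then have "(?D * k) * (chebyshev_quot (Suc m) * ((2 * m + 1) * (m + 1)))
    = (?D * k) * (6 * (6 * m + 1) * (6 * m + 5) * chebyshev_quot m)"
    by (simp only: mult.assoc mult.left_commute[of _ k])
  then show ?thesis
    unfolding mult_cancel1 by (simp add: k_def)
qed

lemma chebyshev_quot_0: "chebyshev_quot 0 = 1"
  by (simp add: chebyshev_quot_def)

lemma chebyshev_quot_le: "chebyshev_quot m \<le> 108 ^ m"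
proof (induction m)
  case 0
  then show ?case by (simp add: chebyshev_quot_0)
next
  case (Suc m)
  have "chebyshev_quot (Suc m) * ((2 * m + 1) * (m + 1)) \<le> 6 * (6 * m + 1) * (6 * m + 5) * 108 ^ m"
    unfolding chebyshev_quot_Suc by (rule mult_left_mono[OF Suc]) simp
  also have "\<dots> \<le> 108 * ((2 * m + 1) * (m + 1)) * 108 ^ m"
    by (intro mult_right_mono) (auto simp: algebra_simps)
  also have "\<dots> = 108 ^ Suc m * ((2 * m + 1) * (m + 1))"
    by (simp only: power_Suc ac_simps)
  finally show ?case
    by (subst (asm) mult_le_cancel2) simp
qed

text \<open>Compared with 108, one step of the recurrence loses at most the factor m / (m + 1),
  which the factor m absorbs. The constants give equality at m = 1, where the quotient is
  30.\<close>

lemma chebyshev_quot_ge: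
  assumes "m > 0"
  shows "5 * 108 ^ m \<le> 18 * m * chebyshev_quot m"
  using assms
proof (induction m rule: nat_induct_non_zero)
  case 1
  then show ?case using chebyshev_quot_Suc[of 0] by (simp add: chebyshev_quot_0)
next
  case (Suc m)
  have "5 * 108 ^ Suc m * ((2 * m + 1) * (m + 1)) \<le> 108 * ((2 * m + 1) * (m + 1)) * (18 * m * chebyshev_quot m)"
    using mult_left_mono[OF Suc.IH, of "108 * ((2 * m + 1) * (m + 1))"]
    by (simp only: power_Suc ac_simps)
  also have "\<dots> \<le> 18 * (m + 1) * (6 * (6 * m + 1) * (6 * m + 5)) * chebyshev_quot m"
    by (simp add: algebra_simps)
  also have "\<dots> = 18 * (m + 1) * chebyshev_quot (Suc m) * ((2 * m + 1) * (m + 1))"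
    using chebyshev_quot_Suc[of m] by (simp only: mult.assoc)
  finally show ?case by (subst (asm) mult_le_cancel2) simp
qed

section \<open>Primorials compared with the Chebyshev quotient\<close>

definition primorial :: "nat \<Rightarrow> nat" where
  "primorial n = \<Prod>{p. prime p \<and> p \<le> n}"

lemma finite_primes_le [simp]: "finite {p :: nat. prime p \<and> p \<le> n}"
  by (rule finite_subset[of _ "{..n}"]) auto

lemma primorial_mono: "m \<le> n \<Longrightarrow> primorial m \<le> primorial n"
  unfolding primorial_def by (intro dvd_imp_le prod_dvd_prod_subset prod_pos) (auto simp: prime_gt_0_nat)

text \<open>A prime p with 2m < p and p \<le> 6m has floor (6m / p) equal to 1 or 2, hence weight 1,
  so it divides the quotient.\<close>

lemma primorial_le_chebyshev_quot: "primorial (6 * m) \<le> primorial (2 * m) * chebyshev_quot m"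
proof -
  let ?P = "{p. prime p \<and> 2 * m < p \<and> p \<le> 6 * m}"
  have fin: "finite ?P" by (rule finite_subset[of _ "{..6*m}"]) auto
  have "multiplicity p (\<Prod>?P) \<le> multiplicity p (chebyshev_quot m)" if p: "prime p" for p
  proof (cases "p \<in> ?P")
    case True
    then have t: "6 * m div p \<ge> 1" "6 * m div p < 3"
      by (auto simp: div_greater_zero_iff Suc_le_eq less_mult_imp_div_less)
    then have "6 * m div p = 1 \<or> 6 * m div p = 2" by linarith
    then have "chebyshev_weight (6 * m div p) = 1"
      by (auto simp: chebyshev_weight_def)
    moreover have "chebyshev_weight (6 * m div p ^ 1) \<le> (\<Sum>i=1..6*m. chebyshev_weight (6 * m div p ^ i))"
      using True by (intro member_le_sum) auto
    ultimately have "multiplicity p (chebyshev_quot m) \<ge> 1"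
      using p by (simp add: multiplicity_chebyshev_quot)
    moreover have "multiplicity p (\<Prod>?P) \<le> 1"
      using squarefree_prod_primes(1)[OF fin] p
      by (cases "p \<in> prime_factors (\<Prod>?P)")
        (auto simp: squarefree_factorial_semiring' prime_factors_multiplicity)
    ultimately show ?thesis by simp
  next
    case False
    then have "p \<notin> prime_factors (\<Prod>?P)"
      using squarefree_prod_primes(2)[OF fin] by auto
    then show ?thesis using p by (simp add: prime_factors_multiplicity)
  qed
  then have "\<Prod>?P dvd chebyshev_quot m"
    by (intro multiplicity_le_imp_dvd) (auto intro: fin dest: prime_gt_0_nat)
  then have "\<Prod>?P \<le> chebyshev_quot m"
    using chebyshev_quot_pos dvd_imp_le by blast
  moreover have "primorial (6 * m) = primorial (2 * m) * \<Prod>?P"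
    unfolding primorial_def using fin
    by (subst prod.union_disjoint[symmetric]) (auto intro!: prod.cong)
  ultimately show ?thesis by simp
qed

text \<open>A prime power dividing the quotient is at most 6m, because larger powers have weight 0.
  This is used for the at most s primes up to s; a prime above s has its square above 6m and so
  occurs at most once.\<close>

lemma chebyshev_quot_le_primorial:
  assumes m: "m > 0" and s: "6 * m < (s + 1)\<^sup>2"
  shows "chebyshev_quot m \<le> (6 * m) ^ s * primorial (6 * m)"
proof -
  let ?E = "chebyshev_quot m"
  let ?A = "{p. prime p \<and> p \<le> 6 * m \<and> p \<le> s}" and ?B = "{p. prime p \<and> p \<le> 6 * m \<and> s < p}"
  have fin: "finite ?A" "finite ?B" by (auto intro!: finite_subset[of _ "{..6*m}"])
  have mult: "multiplicity p ?E \<le> k" if p: "prime p" and k: "6 * m < p ^ Suc k" for p k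
  proof -
    have "chebyshev_weight (6 * m div p ^ i) = 0" if "i \<notin> {1..k}" "i \<in> {1..6*m}" for i
    proof -
      have "p ^ Suc k \<le> p ^ i" using that prime_gt_1_nat[OF p] by (intro power_increasing) auto
      then have "6 * m div p ^ i = 0" using k by simp
      then show ?thesis by (simp add: chebyshev_weight_def)
    qed
    then have "multiplicity p ?E \<le> (\<Sum>i\<in>{1..k}. chebyshev_weight (6 * m div p ^ i))"
      unfolding multiplicity_chebyshev_quot[OF p]
      by (subst sum.mono_neutral_right[of _ "{1..6*m} \<inter> {1..k}"]) (auto intro!: sum_mono2)
    also have "\<dots> \<le> k"
      using sum_bounded_above[of "{1..k}" "\<lambda>i. chebyshev_weight (6 * m div p ^ i)" 1] chebyshev_weight(2)
      by simp
    finally show ?thesis .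
  qed
  have "?E = (\<Prod>p\<in>prime_factors ?E. p ^ multiplicity p ?E)"
    using chebyshev_quot_pos by (intro prime_factorization_nat) auto
  also have "\<dots> = (\<Prod>p\<in>?A \<union> ?B. p ^ multiplicity p ?E)"
  proof (intro prod.mono_neutral_left ballI)
    show "finite (?A \<union> ?B)" using fin by blast
    show "prime_factors ?E \<subseteq> ?A \<union> ?B"
    proof
      fix p assume "p \<in> prime_factors ?E"
      then have p: "prime p" "multiplicity p ?E > 0" by (auto simp: prime_factors_multiplicity)
      then show "p \<in> ?A \<union> ?B" using mult[OF p(1), of 0] by (cases "p \<le> s") (auto simp: not_less[symmetric])
    qed
    fix p assume "p \<in> ?A \<union> ?B - prime_factors ?E"
    then show "p ^ multiplicity p ?E = 1" by (auto simp: prime_factors_multiplicity)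
  qed
  also have "\<dots> = (\<Prod>p\<in>?A. p ^ multiplicity p ?E) * (\<Prod>p\<in>?B. p ^ multiplicity p ?E)"
    using fin by (intro prod.union_disjoint) auto
  also have "\<dots> \<le> (6 * m) ^ s * primorial (6 * m)"
  proof (rule mult_mono)
    have "(\<Prod>p\<in>?A. p ^ multiplicity p ?E) \<le> (6 * m) ^ card ?A"
    proof (rule prod_le_power)
      fix p assume p: "p \<in> ?A"
      then have "p > 1" by (auto dest: prime_gt_1_nat)
      then obtain k where k: "p ^ k \<le> 6 * m" "6 * m < p ^ (k + 1)"
        using ex_power_ivl1[of p "6 * m"] p by auto
      have "p ^ multiplicity p ?E \<le> p ^ k"
        using mult[of p k] p k \<open>p > 1\<close> by (intro power_increasing) auto
      then show "0 \<le> p ^ multiplicity p ?E \<and> p ^ multiplicity p ?E \<le> 6 * m" using k by simp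
    qed (use m in auto)
    also have "\<dots> \<le> (6 * m) ^ s"
    proof -
      have "card ?A \<le> card {1..s}"
        by (rule card_mono) (auto dest: prime_ge_1_nat)
      with m show ?thesis by (intro power_increasing) auto
    qed
    finally show "(\<Prod>p\<in>?A. p ^ multiplicity p ?E) \<le> (6 * m) ^ s" .
    have "(\<Prod>p\<in>?B. p ^ multiplicity p ?E) \<le> \<Prod>?B"
    proof (rule prod_mono)
      fix p assume p: "p \<in> ?B"
      have "(s + 1)\<^sup>2 \<le> p\<^sup>2" using p by (intro power_mono) auto
      then have "multiplicity p ?E \<le> 1"
        using mult[of p 1] p s by (simp add: power2_eq_square)
      then have "p ^ multiplicity p ?E \<le> p ^ 1"
        using p by (intro power_increasing) (auto dest: prime_ge_1_nat)
      then show "0 \<le> p ^ multiplicity p ?E \<and> p ^ multiplicity p ?E \<le> p" by simp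
    qed
    also have "\<dots> \<le> primorial (6 * m)"
      unfolding primorial_def
      by (intro dvd_imp_le prod_dvd_prod_subset prod_pos) (auto simp: prime_gt_0_nat)
    finally show "(\<Prod>p\<in>?B. p ^ multiplicity p ?E) \<le> primorial (6 * m)" .
  qed auto
  finally show ?thesis .
qed

section \<open>Prime gaps\<close>

lemma primorial_power2_le_small:
  assumes "n < 127"
  shows "(primorial n)\<^sup>2 \<le> 12 ^ n"
proof -
  \<comment> \<open>A test that simplification can evaluate and that every prime passes: being 2, 3
    or 5, or coprime to 30. Composites that pass only enlarge the product.\<close>
  define Q :: "nat \<Rightarrow> bool" where
    "Q = (\<lambda>k. k \<in> {2, 3, 5} \<or> k mod 2 \<noteq> 0 \<and> k mod 3 \<noteq> 0 \<and> k mod 5 \<noteq> 0)"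
  have Q: "Q p" if "prime p" for p
    using that primes_dvd_imp_eq[of 2 p] primes_dvd_imp_eq[of 3 p] primes_dvd_imp_eq[of 5 p]
    by (auto simp: Q_def mod_eq_0_iff_dvd)
  have le: "(primorial n)\<^sup>2 \<le> 12 ^ n"
    if "(prod_list (filter Q [2..<b]))\<^sup>2 \<le> 12 ^ a" "a \<le> n" "n < b" for a b
  proof -
    have "primorial n \<le> \<Prod>(set (filter Q [2..<b]))"
      unfolding primorial_def using \<open>n < b\<close>
      by (intro dvd_imp_le prod_dvd_prod_subset prod_pos) (auto simp: Q dest: prime_ge_2_nat)
    also have "\<dots> = prod_list (filter Q [2..<b])"
      using prod.distinct_set_conv_list[of "filter Q [2..<b]" "\<lambda>x. x"] by simp
    finally have "(primorial n)\<^sup>2 \<le> (prod_list (filter Q [2..<b]))\<^sup>2"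
      by (intro power_mono) auto
    also have "\<dots> \<le> 12 ^ a" by (rule that)
    also have "\<dots> \<le> 12 ^ n" using that by (intro power_increasing) auto
    finally show ?thesis .
  qed
  (* The breakpoints are chosen greedily from the top. *)
  have check: "(prod_list (filter Q [2..<2]))\<^sup>2 \<le> 12 ^ 0" "(prod_list (filter Q [2..<5]))\<^sup>2 \<le> 12 ^ 2"
    "(prod_list (filter Q [2..<11]))\<^sup>2 \<le> 12 ^ 5" "(prod_list (filter Q [2..<19]))\<^sup>2 \<le> 12 ^ 11"
    "(prod_list (filter Q [2..<30]))\<^sup>2 \<le> 12 ^ 19" "(prod_list (filter Q [2..<46]))\<^sup>2 \<le> 12 ^ 30"
    "(prod_list (filter Q [2..<67]))\<^sup>2 \<le> 12 ^ 46" "(prod_list (filter Q [2..<86]))\<^sup>2 \<le> 12 ^ 67"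
    "(prod_list (filter Q [2..<105]))\<^sup>2 \<le> 12 ^ 86" "(prod_list (filter Q [2..<127]))\<^sup>2 \<le> 12 ^ 105"
    unfolding Q_def by (simp_all add: upt_rec_numeral)
  consider "n < 2" | "2 \<le> n" "n < 5" | "5 \<le> n" "n < 11" | "11 \<le> n" "n < 19" | "19 \<le> n" "n < 30"
    | "30 \<le> n" "n < 46" | "46 \<le> n" "n < 67" | "67 \<le> n" "n < 86" | "86 \<le> n" "n < 105"
    | "105 \<le> n" "n < 127"
    using assms by linarith
  then show ?thesis
    by cases (use check[THEN le] in auto)
qed

text \<open>With m = n/6 rounded up, \<open>primorial n\<close> is at most
  \<open>primorial (2 * m)\<close> times 108^m. By induction its square is at most (12 * 108)^(2m) =
  1679616^m, which beats 12^(6m) = 2985984^m by the factor (16/9)^m.\<close>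

lemma primorial_power2_le: "(primorial n)\<^sup>2 \<le> 12 ^ n"
proof (induction n rule: less_induct)
  case (less n)
  show ?case
  proof (cases "n < 127")
    case True
    then show ?thesis by (rule primorial_power2_le_small)
  next
    case False
    define m where "m = (n + 5) div 6"
    have m: "n \<le> 6 * m" "6 * m \<le> n + 5" "22 \<le> m" "2 * m < n"
      using False unfolding m_def by linarith+
    \<comment> \<open>The factor 12^5 pays for rounding n up to 6m. The least k with (16/9)^k \<ge>
      12^5 is 22, which is why the small cases extend to 126.\<close>
    have pow: "12 ^ 5 * 1679616 ^ k \<le> (2985984 :: nat) ^ k" if "22 \<le> k" for k
      using that
    proof (induction k rule: dec_induct)
      case (step k)
      then show ?case unfolding power_Suc by linarith
    qed simp
    have "primorial n \<le> primorial (2 * m) * 108 ^ m"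
      using primorial_mono[OF m(1)] primorial_le_chebyshev_quot[of m]
        mult_left_mono[OF chebyshev_quot_le[of m], of "primorial (2 * m)"] by linarith
    then have "(primorial n)\<^sup>2 \<le> (primorial (2 * m))\<^sup>2 * (108 ^ m)\<^sup>2"
      unfolding power_mult_distrib[symmetric] by (intro power_mono) auto
    also have "\<dots> \<le> 12 ^ (2 * m) * (108 ^ m)\<^sup>2"
      using less.IH[OF m(4)] by simp
    also have "\<dots> = 1679616 ^ m"
      by (simp only: power_mult power2_eq_square power_mult_distrib[symmetric]) simp
    finally have "12 ^ 5 * (primorial n)\<^sup>2 \<le> 12 ^ 5 * 1679616 ^ m" by simp
    also have "\<dots> \<le> 2985984 ^ m" using m(3) by (rule pow)
    also have "\<dots> = 12 ^ (6 * m)" by (simp add: power_mult)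
    also have "\<dots> \<le> 12 ^ (n + 5)" using m by (intro power_increasing) auto
    finally show ?thesis by (simp add: power_add)
  qed
qed

section \<open>Certified primes and the gap bound\<close>

definition no_divisor :: "nat \<Rightarrow> nat \<Rightarrow> nat \<Rightarrow> bool" where
  "no_divisor p a b \<longleftrightarrow> (\<forall>d\<in>{a..<b}. \<not> d dvd p)"

text \<open>One step of trial division. Its instance \<open>no_divisor_numeral\<close> for literal
  bounds lets simplification run the whole test.\<close>

lemma no_divisor_rec:
  "no_divisor p a b \<longleftrightarrow>
    (if a < b then if p mod a = 0 then False else no_divisor p (Suc a) b else True)"
  unfolding no_divisor_def by (auto simp: dvd_eq_mod_eq_0 Suc_le_eq order_le_less)

lemmas no_divisor_numeral = no_divisor_rec[of _ "numeral a" "numeral b" for a b]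

lemma no_divisor_imp_prime:
  assumes "1 < p" "p < s\<^sup>2" "no_divisor p 2 s"
  shows "prime p"
proof (rule ccontr)
  assume "\<not> prime p"
  then obtain a where "a dvd p" "a \<noteq> 1" "a \<noteq> p"
    using \<open>1 < p\<close> unfolding prime_nat_iff by blast
  then obtain b where ab: "p = a * b" "1 < a" "1 < b"
    using \<open>1 < p\<close> by (metis dvdE mult.right_neutral mult_0 mult_0_right less_one nat_neq_iff not_less_zero)
  have "\<not> c < s" if "c dvd p" "1 < c" for c
    using assms(3) that by (auto simp: no_divisor_def)
  then have "\<not> a < s" "\<not> b < s" using ab by simp_all
  then have "s * s \<le> p" unfolding ab by (intro mult_le_mono) auto
  then show False using assms(2) by (simp add: power2_eq_square)
qed

text \<open>The bound is (7/5)^3, so that cube roots are easy to take later. It follows from exp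
  (-1/64) \<ge> 63/64 by taking 64th powers.\<close>

lemma exp_1_le: "exp 1 \<le> (343 / 125 :: real)"
proof -
  have "(63 / 64) ^ 64 \<le> exp (-1 / 64 :: real) ^ 64"
    using exp_ge_add_one_self[of "-1 / 64"] by (intro power_mono) auto
  also have "exp (-1 / 64 :: real) ^ 64 = exp (-1)"
    using exp_of_nat_mult[of 64 "-1 / 64 :: real"] by simp
  finally have "exp (-1) \<ge> (125 / 343 :: real)"
    by (rule order_trans[rotated]) (simp add: power_divide)
  then show ?thesis by (simp add: exp_minus field_simps)
qed

lemma prime_gap_large:
  fixes x :: nat
  assumes "x \<ge> 100000"
  shows "\<exists>r. prime r \<and> x < r \<and> 3 * r < 5 * x"
proof (rule ccontr)
  assume no: "\<nexists>r. prime r \<and> x < r \<and> 3 * r < 5 * x"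
  \<comment> \<open>The largest m with 6m < 5x/3; by assumption every prime up to 6m is then at most
    x.\<close>
  define m where "m = (5 * x - 1) div 18"
  define y where "y = sqrt (6 * m)"
  define s where "s = nat \<lfloor>y\<rfloor>"
  have m: "18 * m < 5 * x" "5 * x \<le> 18 * m + 18" "m \<ge> 27777"
    using assms unfolding m_def by linarith+
  have y2: "y\<^sup>2 = 6 * m" by (simp add: y_def)
  have "(400 :: real)\<^sup>2 \<le> y\<^sup>2" unfolding y2 using m by simp
  then have y: "y \<ge> 400" by (rule power2_le_imp_le) (simp add: y_def)
  have "real (6 * m) < (s + 1)\<^sup>2"
  proof -
    have "y < s + 1" unfolding s_def using y by linarith
    then have "y\<^sup>2 < (s + 1)\<^sup>2" using y unfolding of_nat_power by (intro power_strict_mono) auto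
    then show ?thesis using y2 by simp
  qed
  then have s: "6 * m < (s + 1)\<^sup>2" by (simp only: of_nat_less_iff)
  have s': "real s \<le> y" unfolding s_def using y by simp
  have "primorial (6 * m) \<le> primorial x"
  proof -
    have "p \<le> x" if "prime p" "p \<le> 6 * m" for p
    proof (rule ccontr)
      assume "\<not> p \<le> x"
      then have "x < p" "3 * p < 5 * x" using that m(1) by linarith+
      then show False using no that by blast
    qed
    then show ?thesis
      unfolding primorial_def
      by (intro dvd_imp_le prod_dvd_prod_subset prod_pos) (auto simp: prime_gt_0_nat)
  qed
  then have "(primorial (6 * m))\<^sup>2 \<le> (primorial x)\<^sup>2" by (intro power_mono) auto
  also have "\<dots> \<le> 12 ^ x" by (rule primorial_power2_le)
  finally have prim: "(primorial (6 * m))\<^sup>2 \<le> 12 ^ x" .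
  have "(5 * 108 ^ m)\<^sup>2 \<le> (18 * m * chebyshev_quot m)\<^sup>2"
    using chebyshev_quot_ge[of m] m by (intro power_mono) auto
  also have "\<dots> \<le> (18 * m * ((6 * m) ^ s * primorial (6 * m)))\<^sup>2"
    using chebyshev_quot_le_primorial[OF _ s] m by (intro power_mono mult_left_mono) auto
  also have "\<dots> = (18 * m)\<^sup>2 * ((6 * m) ^ s)\<^sup>2 * (primorial (6 * m))\<^sup>2"
    by (simp only: power_mult_distrib mult.assoc)
  also have "\<dots> \<le> (18 * m)\<^sup>2 * ((6 * m) ^ s)\<^sup>2 * 12 ^ x"
    using prim by (intro mult_left_mono) auto
  finally have "real ((5 * 108 ^ m)\<^sup>2) \<le> real ((18 * m)\<^sup>2 * ((6 * m) ^ s)\<^sup>2 * 12 ^ x)"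
    by (simp only: of_nat_le_iff)
  then have "ln (real ((5 * 108 ^ m)\<^sup>2)) \<le> ln (real ((18 * m)\<^sup>2 * ((6 * m) ^ s)\<^sup>2 * 12 ^ x))"
    using m by (subst ln_le_cancel_iff) auto
  also have "ln (real ((5 * 108 ^ m)\<^sup>2)) = 2 * (ln 5 + m * ln 108)"
    unfolding of_nat_power of_nat_mult of_nat_numeral
    by (subst ln_realpow) (auto simp: ln_mult ln_realpow)
  also have "ln (real ((18 * m)\<^sup>2 * ((6 * m) ^ s)\<^sup>2 * 12 ^ x))
    = 2 * ln (3 * y\<^sup>2) + 2 * s * ln (y\<^sup>2) + x * ln 12"
  proof -
    have "ln (a\<^sup>2 * (b ^ s)\<^sup>2 * c ^ x) = 2 * ln a + 2 * s * ln b + x * ln c"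
      if "a > 0" "b > 0" "c > 0" for a b c :: real
      using that by (simp add: ln_mult ln_realpow)
    from this[of "18 * m" "6 * m" 12] show ?thesis
      unfolding y2 using m by simp
  qed
  finally have main: "2 * (ln 5 + m * ln 108) \<le> 2 * ln (3 * y\<^sup>2) + 2 * s * ln (y\<^sup>2) + x * ln 12" .
  (* The decisive margin: 108 > 12^(9/5) * exp (1/5). *)
  have "exp 1 \<le> (59049 / 20736 :: real)"
    using exp_1_le by (rule order_trans) simp
  then have "ln (exp 1) \<le> ln (59049 / 20736 :: real)" by (subst ln_le_cancel_iff) auto
  also have "(59049 / 20736 :: real) = 108 ^ 5 / 12 ^ 9" by simp
  also have "ln \<dots> = ln (108 ^ 5) - ln (12 ^ 9 :: real)"
    by (rule ln_divide_pos) simp_all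
  also have "\<dots> = 5 * ln 108 - 9 * ln (12 :: real)"
    using ln_realpow[of 108 5] ln_realpow[of 12 9] by (simp del: power_numeral)
  finally have ln108: "5 * ln 108 - 9 * ln 12 \<ge> (1 :: real)" by simp
  \<comment> \<open>The logarithm of y is bounded by its tangent at exp 6, with slope 1 / exp 6
    \<le> 1/380; 1.28125 is 1 + 1/4 + (1/4)^2 / 2.\<close>
  have "(1.28125 :: real) ^ 24 \<le> exp (1/4) ^ 24"
    using exp_lower_Taylor_quadratic[of "1/4"] by (intro power_mono) (auto simp: power2_eq_square)
  also have "exp (1/4 :: real) ^ 24 = exp 6"
    using exp_of_nat_mult[of 24 "1/4 :: real"] by simp
  finally have e6: "380 \<le> exp (6 :: real)" by (simp add: power_divide)
  have "ln y = ln (y / exp 6) + 6" using y by (simp add: ln_div)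
  also have "\<dots> \<le> y / exp 6 - 1 + 6" using y ln_le_minus_one[of "y / exp 6"] by simp
  also have "y / exp 6 \<le> y / 380" using y e6 by (intro divide_left_mono) auto
  finally have lny: "ln y \<le> y / 380 + 5" by simp
  have ln3: "ln 3 \<le> (2 :: real)" and ln2: "ln 2 \<le> (1 :: real)"
    using ln_le_minus_one[of "3::real"] ln_le_minus_one[of "2::real"] by auto
  have ln12: "ln 12 \<le> (4 :: real)"
    using ln_mult_pos[of 2 "6::real"] ln_mult_pos[of 2 "3::real"] ln3 ln2 by simp
  have "5 * real x \<le> 18 * m + 18" using m(2) by linarith
  then have "5 * real x * ln 12 \<le> (18 * m + 18) * ln 12"
    by (rule mult_right_mono) simp
  then have "5 * (x * ln 12) \<le> 18 * (m * ln 12) + 18 * ln 12"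
    by (simp add: algebra_simps)
  moreover have "m + 9 * (m * ln 12) \<le> 5 * (m * ln 108)"
    using mult_left_mono[OF ln108, of "real m"] by (simp add: algebra_simps)
  moreover have "2 * ln 5 + 2 * (m * ln 108) \<le> 2 * ln 3 + 4 * ln y + 4 * (s * ln y) + x * ln 12"
    using main y by (simp add: ln_mult ln_realpow algebra_simps)
  moreover have "ln 5 \<ge> (0 :: real)" by simp
  ultimately have "2 * real m \<le> 92 + 20 * ln y + 20 * (s * ln y)"
    using ln12 ln3 by linarith
  also have "s * ln y \<le> y * (y / 380 + 5)"
    using s' lny y by (intro mult_mono) auto
  finally have "2 * real m \<le> 92 + 20 * (y / 380 + 5) + 20 * (y * (y / 380 + 5))"
    using lny by simp
  moreover have "real m = y\<^sup>2 / 6" using y2 by simp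
  \<comment> \<open>Here 2m = y^2 / 3 and 20/380 = 1/19. At y = 400 the left side is over 112 y, the
    right side less than 101 y; the threshold 100000 for x ensures y \<ge> 400.\<close>
  ultimately have "y * y * (1/3 - 1/19) \<le> 192 + y / 19 + 100 * y"
    by (simp add: power2_eq_square algebra_simps)
  moreover have "400 * y \<le> y * y" using y by (intro mult_right_mono) auto
  ultimately show False using y by simp
qed

text \<open>The first member of the chain above x is less than 5/3 of its predecessor, which is at
  most x.\<close>

lemma prime_chain:
  fixes x :: nat
  assumes "successively (\<lambda>p q. 3 * q < 5 * p) (a # ps)" "list_all prime ps" "a \<le> x" "x < last (a # ps)"
  shows "\<exists>r. prime r \<and> x < r \<and> 3 * r < 5 * x"
  using assms
proof (induction ps arbitrary: a)
  case Nil
  then show ?case by simp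
next
  case (Cons p ps)
  show ?case
  proof (cases "x < p")
    case True
    then show ?thesis using Cons.prems by (intro exI[of _ p]) auto
  next
    case False
    then show ?thesis using Cons.prems by (intro Cons.IH[of p]) auto
  qed
qed

lemma prime_gap:
  fixes x :: nat
  assumes "x \<ge> 5"
  shows "\<exists>r. prime r \<and> x < r \<and> 3 * r < 5 * x"
proof (cases "x < 100000")
  case False
  then show ?thesis by (intro prime_gap_large) simp
next
  case True
  (* Each prime is paired with a bound for trial division and is the largest one below 5/3 of its
     predecessor, starting from 5. *)
  define qs :: "(nat \<times> nat) list" where "qs = [
    (7, 3), (11, 4), (17, 5), (23, 5), (37, 7), (61, 8), (101, 11), (167, 13), (277,
    17), (461, 22), (761, 28), (1259, 36), (2089, 46), (3469, 59), (5779, 77), (9631,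
    99), (16033, 127), (26717, 164), (44519, 211), (74197, 273), (123661, 352)]"
  have "list_all (\<lambda>(p, s). 1 < p \<and> p < s\<^sup>2 \<and> no_divisor p 2 s) qs"
    unfolding qs_def by (simp add: no_divisor_numeral)
  then have "list_all prime (map fst qs)"
    by (fastforce simp: list_all_iff intro: no_divisor_imp_prime)
  moreover have "successively (\<lambda>p q. 3 * q < 5 * p) (5 # map fst qs)" "100000 \<le> last (5 # map fst qs)"
    by (simp_all add: qs_def)
  ultimately show ?thesis
    using assms True by (intro prime_chain[of 5 "map fst qs"]) linarith+
qed

section \<open>Lowering primes in a set\<close>

definition prime_set :: "nat set \<Rightarrow> bool" where
  "prime_set A \<longleftrightarrow> finite A \<and> (\<forall>p\<in>A. prime p)"

definition first_primes :: "nat \<Rightarrow> nat set" where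
  "first_primes j = nth_prime ` {1..j}"

lemma prime_set_first_primes: "prime_set (first_primes j)"
  by (simp add: prime_set_def first_primes_def prime_nth_prime)

lemma card_first_primes: "card (first_primes j) = j"
  by (simp only: first_primes_def card_image[OF inj_on_nth_prime]) simp

lemma sum_first_primes: "\<Sum>(first_primes j) = sigma j"
  by (simp only: first_primes_def sigma_def sum.reindex[OF inj_on_nth_prime]) simp

lemma prod_prime_set_pos: "prime_set A \<Longrightarrow> \<Prod>A > 0"
  by (auto simp: prime_set_def intro!: prod_pos prime_gt_0_nat)

lemma first_primes_down_closed:
  assumes "p \<in> first_primes j" "prime r" "r < p"
  shows "r \<in> first_primes j"
proof -
  obtain i where i: "i \<in> {1..j}" "p = enumerate {p. prime p} (i - 1)"
    using assms(1) by (auto simp: first_primes_def nth_prime_def)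
  obtain k where k: "enumerate {p. prime p} k = r"
    using enumerate_Ex[OF primes_infinite, of r] assms(2) by auto
  have "k < i - 1"
    using assms(3) enumerate_mono_iff[OF primes_infinite, of k "i - 1"] unfolding i k[symmetric] by simp
  then show ?thesis
    using i k by (auto simp: first_primes_def nth_prime_def intro!: image_eqI[of _ _ "Suc k"])
qed

text \<open>Two initial segments of the primes are comparable by inclusion, so equal cardinality
  makes them equal.\<close>

lemma prime_set_down_closed_imp_first_primes:
  assumes "prime_set B" and down: "\<And>p r. p \<in> B \<Longrightarrow> prime r \<Longrightarrow> r < p \<Longrightarrow> r \<in> B"
  shows "B = first_primes (card B)"
proof -
  let ?F = "first_primes (card B)"
  have p: "prime p" if "p \<in> B \<or> p \<in> ?F" for p
    using that assms(1) prime_set_first_primes unfolding prime_set_def by blast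
  have "B \<subseteq> ?F \<or> ?F \<subseteq> B"
  proof (rule disjCI)
    assume "\<not> ?F \<subseteq> B"
    then obtain f where f: "f \<in> ?F" "f \<notin> B" by blast
    show "B \<subseteq> ?F"
    proof
      fix b assume "b \<in> B"
      then show "b \<in> ?F"
        using f down[of b f] first_primes_down_closed[of f _ b] p[of b] p[of f]
        by (cases b f rule: linorder_cases) auto
    qed
  qed
  moreover have "finite B" "finite ?F"
    using assms(1) prime_set_first_primes by (auto simp: prime_set_def)
  ultimately show ?thesis
    using card_subset_eq[of B ?F] card_subset_eq[of ?F B] card_first_primes by auto
qed

text \<open>Some prime t outside B lies below an element of B. Let q be the least element of B above
  t and r the prime preceding q: either r = t, or t < r < q and minimality of q keeps r out of
  B.\<close>

lemma obtain_consecutive_primes: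
  assumes "prime_set B" "B \<noteq> first_primes (card B)"
  obtains q r where "q \<in> B" "r \<notin> B" "prime r" "prime q" "r < q"
    "\<And>s. prime s \<Longrightarrow> r < s \<Longrightarrow> q \<le> s"
proof -
  obtain p t where pt: "p \<in> B" "prime t" "t < p" "t \<notin> B"
    using prime_set_down_closed_imp_first_primes assms by metis
  define q where "q = Min {b \<in> B. t < b}"
  define r where "r = Max {s. prime s \<and> s < q}"
  have finB: "finite {b \<in> B. t < b}" using assms(1) by (simp add: prime_set_def)
  have q: "q \<in> B" "t < q" using Min_in[OF finB] pt unfolding q_def by auto
  have qmin: "q \<le> b" if "b \<in> B" "t < b" for b
    unfolding q_def using finB that by (intro Min_le) auto
  have fin: "finite {s. prime s \<and> s < q}" by (rule finite_subset[of _ "{..<q}"]) auto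
  have r: "prime r" "r < q" using Max_in[OF fin] pt(2) q(2) unfolding r_def by blast+
  have rmax: "s \<le> r" if "prime s" "s < q" for s
    unfolding r_def using fin that by (intro Max_ge) auto
  have "r \<notin> B"
    using qmin[of r] rmax[of t] pt q r by (cases "r = t") auto
  moreover have "prime q" using q assms(1) by (auto simp: prime_set_def)
  ultimately show ?thesis
    using that[of q r] q r rmax by (meson not_le)
qed

text \<open>The ratio 5/3 can be attained only at r = 3; this is where equality in the theorem comes
  from.\<close>

lemma consecutive_primes_ratio:
  fixes q r :: nat
  assumes "prime r" "r \<ge> 3" "\<And>s. prime s \<Longrightarrow> r < s \<Longrightarrow> q \<le> s"
  shows "3 * q \<le> 5 * r" "r \<ge> 5 \<Longrightarrow> 3 * q < 5 * r"
proof -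
  show *: "3 * q < 5 * r" if r5: "r \<ge> 5"
  proof -
    obtain s where "prime s" "r < s" "3 * s < 5 * r" using prime_gap[OF r5] by blast
    then show ?thesis using assms(3)[of s] by linarith
  qed
  have "r \<noteq> 4" using assms(1) by auto
  then consider "r = 3" | "r \<ge> 5" using assms(2) by linarith
  then show "3 * q \<le> 5 * r"
  proof cases
    case 1
    have "prime (5 :: nat)" by simp
    then show ?thesis using assms(3)[of 5] 1 by linarith
  qed (use * in linarith)
qed

section \<open>The cost of lowering primes, once and repeatedly\<close>

lemma lower_prime:
  assumes "prime_set B" "q \<in> B" "r \<notin> B" "prime r" "r < q"
  defines "C \<equiv> insert r (B - {q})"
  shows "prime_set C" "card C = card B" "\<Sum>C + q = \<Sum>B + r" "\<Prod>C * q = \<Prod>B * r" "\<Sum>C < \<Sum>B"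
proof -
  have fin: "finite (B - {q})" "finite B" using assms(1) by (auto simp: prime_set_def)
  have r: "r \<notin> B - {q}" using assms(3) by blast
  show "prime_set C" using assms(1,4) by (auto simp: prime_set_def C_def)
  show "card C = card B"
    unfolding C_def card_insert_disjoint[OF fin(1) r] using card.remove[OF fin(2) assms(2)] by simp
  show *: "\<Sum>C + q = \<Sum>B + r"
    unfolding C_def sum.insert[OF fin(1) r] using sum.remove[OF fin(2) assms(2), of "\<lambda>x. x"] by simp
  show "\<Prod>C * q = \<Prod>B * r"
    unfolding C_def prod.insert[OF fin(1) r] using prod.remove[OF fin(2) assms(2), of "\<lambda>x. x"] by simp
  show "\<Sum>C < \<Sum>B" using * \<open>r < q\<close> by linarith
qed

text \<open>From 1 + x \<le> exp x. The loss in the product is expressed by the drop in the sum, so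
  that successive losses telescope.\<close>

lemma consecutive_ratio_le_exp:
  fixes q r m :: nat
  assumes "0 < m" "m \<le> r" "r < q"
  shows "real q \<le> r * exp ((real q - real r) / m)"
proof -
  have "real q = r * (1 + (real q - real r) / r)" using assms by (simp add: field_simps)
  also have "\<dots> \<le> r * (1 + (real q - real r) / m)"
    using assms by (intro mult_left_mono add_left_mono divide_left_mono) auto
  also have "\<dots> \<le> r * exp ((real q - real r) / m)"
    by (intro mult_left_mono exp_ge_add_one_self) auto
  finally show ?thesis .
qed

text \<open>The invariant of the inductions below: an exponential bound for the lowered set carries
  back to the set before the replacement.\<close>

lemma prod_le_lower_prime:
  fixes m :: nat
  assumes "0 < m" "m \<le> r" "r < q" "\<Sum>C + q = \<Sum>B + r" "\<Prod>C * q = \<Prod>B * r"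
    and C: "real (\<Prod>C) \<le> X * exp ((real (\<Sum>C) - c) / m)"
  shows "real (\<Prod>B) \<le> X * exp ((real (\<Sum>B) - c) / m)"
proof -
  let ?a = "(real (\<Sum>C) - c) / m" and ?b = "(real q - real r) / m"
  have "real (\<Sum>C) + real q = real (\<Sum>B) + real r"
    using assms(4) by linarith
  then have ab: "?a + ?b = (real (\<Sum>B) - c) / m"
    unfolding add_divide_distrib[symmetric] by (intro arg_cong2[where f = "(/)"]) linarith+
  have "real (\<Prod>B) * real r = real (\<Prod>C) * real q"
    using assms(5) by (metis of_nat_mult)
  also have "\<dots> \<le> (X * exp ?a) * (real r * exp ?b)"
    using C consecutive_ratio_le_exp[OF assms(1-3)] order_trans[OF of_nat_0_le_iff C]
    by (intro mult_mono) (assumption | rule of_nat_0_le_iff)+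
  also have "\<dots> = X * exp (?a + ?b) * real r"
    unfolding exp_add by (simp only: mult.assoc mult.left_commute mult.commute)
  finally show ?thesis
    unfolding ab using assms(1,2) by (subst (asm) mult_le_cancel_right_pos) linarith+
qed

text \<open>Lowering decreases the sum and can only stop at the first primes.\<close>

lemma sigma_le_sum_prime_set:
  assumes "prime_set B"
  shows "sigma (card B) \<le> \<Sum>B"
  using assms
proof (induction "\<Sum>B" arbitrary: B rule: less_induct)
  case less
  show ?case
  proof (cases "B = first_primes (card B)")
    case True
    show ?thesis using sum_first_primes[of "card B", folded True] by simp
  next
    case False
    then obtain q r where qr: "q \<in> B" "r \<notin> B" "prime r" "r < q"
      using obtain_consecutive_primes[OF less.prems] by metis
    show ?thesis
      using less.hyps[of "insert r (B - {q})"] lower_prime[OF less.prems qr] by simp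
  qed
qed

text \<open>Lowering goes on to the end. Each r is at least m since it is missing, and q > r, so the
  primes below m are never touched.\<close>

lemma prod_le_first_primes:
  fixes m :: nat
  assumes "prime_set B" "\<And>s. prime s \<Longrightarrow> s < m \<Longrightarrow> s \<in> B" "0 < m"
  shows "real (\<Prod>B) \<le> \<Prod>(first_primes (card B)) * exp ((real (\<Sum>B) - sigma (card B)) / m)"
  using assms(1,2)
proof (induction "\<Sum>B" arbitrary: B rule: less_induct)
  case less
  show ?case
  proof (cases "B = first_primes (card B)")
    case True
    show ?thesis
      using sum_first_primes[of "card B", folded True] unfolding True[symmetric]
      by (simp del: of_nat_sum of_nat_prod)
  next
    case False
    then obtain q r where qr: "q \<in> B" "r \<notin> B" "prime r" "r < q"
      using obtain_consecutive_primes[OF less.prems(1)] by metis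
    note C = lower_prime[OF less.prems(1) qr]
    have "m \<le> r" using less.prems(2)[OF qr(3)] qr(2) by (meson not_le)
    moreover from this have "s \<in> insert r (B - {q})" if "prime s" "s < m" for s
      using less.prems(2)[OF that] that qr by auto
    ultimately show ?thesis
      using prod_le_lower_prime[OF \<open>0 < m\<close> _ qr(4) C(3,4)] less.hyps[OF C(5,1)] unfolding C(2)
      by blast
  qed
qed

text \<open>Lowering stops as soon as the sum is at most c. Before the last replacement the sum is
  still at least c + 1, so the earlier ones lower it by at most the sum of B minus c + 1; the last
  costs at most 5/3.\<close>

lemma lower_prime_set:
  fixes c m :: nat
  assumes "prime_set B" "\<And>s. prime s \<Longrightarrow> s < m \<Longrightarrow> s \<in> B" "3 \<le> m"
    "sigma (card B) \<le> c" "c < \<Sum>B"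
  shows "\<exists>C. prime_set C \<and> card C = card B \<and> \<Sum>C \<le> c \<and>
    real (\<Prod>B) \<le> 5 / 3 * \<Prod>C * exp ((real (\<Sum>B) - (c + 1)) / m)"
  using assms(1,2,4,5)
proof (induction "\<Sum>B" arbitrary: B rule: less_induct)
  case less
  have "B \<noteq> first_primes (card B)"
    using less.prems(3,4) sum_first_primes[of "card B"] by (metis not_le)
  then obtain q r where qr: "q \<in> B" "r \<notin> B" "prime r" "r < q"
    and consec: "\<And>s. prime s \<Longrightarrow> r < s \<Longrightarrow> q \<le> s"
    using obtain_consecutive_primes[OF less.prems(1)] by metis
  define C where "C = insert r (B - {q})"
  note C = lower_prime[OF less.prems(1) qr, folded C_def]
  have r: "m \<le> r" using less.prems(2)[OF qr(3)] qr(2) by (meson not_le)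
  then have sub: "s \<in> C" if "prime s" "s < m" for s
    using less.prems(2)[OF that] that qr by (auto simp: C_def)
  show ?case
  proof (cases "\<Sum>C \<le> c")
    case True
    have "3 * q \<le> 5 * r"
      using consecutive_primes_ratio(1)[OF qr(3) _ consec] r assms(3) by simp
    then have "\<Prod>B * (3 * q) \<le> \<Prod>B * (5 * r)" by (rule mult_left_mono) simp
    also have "\<dots> = 5 * \<Prod>C * q" using C(4) by (simp add: mult.assoc)
    finally have "3 * \<Prod>B \<le> 5 * \<Prod>C" using qr(4) by simp
    then have "real (\<Prod>B) \<le> 5 / 3 * \<Prod>C * 1" by linarith
    also have "\<dots> \<le> 5 / 3 * \<Prod>C * exp ((real (\<Sum>B) - (c + 1)) / m)"
      using less.prems(4) by (intro mult_left_mono) (auto simp del: of_nat_prod of_nat_sum)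
    finally show ?thesis using C True by blast
  next
    case False
    then obtain D where D: "prime_set D" "card D = card B" "\<Sum>D \<le> c"
      "real (\<Prod>C) \<le> 5 / 3 * \<Prod>D * exp ((real (\<Sum>C) - (c + 1)) / m)"
      using less.hyps[OF C(5,1) sub] less.prems(3) C(2) by auto
    have "real (\<Prod>B) \<le> 5 / 3 * \<Prod>D * exp ((real (\<Sum>B) - (c + 1)) / m)"
      using assms(3) by (intro prod_le_lower_prime[OF _ r qr(4) C(3,4) D(4)]) simp
    then show ?thesis using D by blast
  qed
qed

section \<open>Adjoining the least missing prime: the inequality and its equality case\<close>

lemma exp_le_inverse:
  fixes x :: real
  assumes "x < 1"
  shows "exp x \<le> 1 / (1 - x)"
proof -
  have "1 - x \<le> exp (-x)" using exp_ge_add_one_self[of "-x"] by simp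
  then show ?thesis using assms by (simp add: exp_minus field_simps)
qed

text \<open>If p is odd, p + 1 is even and not prime, so once p is adjoined all primes below p + 2
  are present. This permits m = p + 2 in the lowering lemmas.\<close>

lemma obtain_least_missing_prime:
  assumes "prime_set A"
  obtains p where "prime p" "p \<notin> A"
    "p \<noteq> 2 \<Longrightarrow> odd p \<and> 3 \<le> p" "\<And>s. prime s \<Longrightarrow> p \<noteq> 2 \<Longrightarrow> s < p + 2 \<Longrightarrow> s \<in> insert p A"
proof -
  define p where "p = (LEAST p. prime p \<and> p \<notin> A)"
  have "\<exists>p. prime p \<and> p \<notin> A"
    using primes_infinite finite_subset[of "{p. prime p}" A] assms by (auto simp: prime_set_def)
  then have p: "prime p" "p \<notin> A"
    using LeastI_ex[of "\<lambda>p. prime p \<and> p \<notin> A"] unfolding p_def by auto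
  have least: "s \<in> A" if "prime s" "s < p" for s
    using not_less_Least[of s "\<lambda>p. prime p \<and> p \<notin> A"] that unfolding p_def by auto
  have odd: "odd p \<and> 3 \<le> p" if "p \<noteq> 2"
    using p(1) that prime_ge_2_nat[of p] prime_odd_nat[of p] by auto
  have "s \<in> insert p A" if "prime s" "p \<noteq> 2" "s < p + 2" for s
  proof -
    have "s \<noteq> p + 1" using odd[OF that(2)] prime_odd_nat[OF that(1)] by auto
    then show ?thesis using least that by (cases "s = p") auto
  qed
  then show thesis using that p odd by blast
qed

lemma two_le_odd_primes_diff:
  assumes "prime (r :: nat)" "prime q" "2 < r" "r < q"
  shows "r + 2 \<le> q"
proof -
  have "odd r" "odd q" using assms prime_odd_nat by auto
  then show ?thesis using \<open>r < q\<close> by presburger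
qed

lemma add_prime_factor:
  assumes A: "prime_set A" "Suc (card A) = j" "\<Sum>A \<le> n" "sigma j \<le> n"
  shows "\<exists>C. prime_set C \<and> card C = j \<and> \<Sum>C \<le> n \<and> 6 * \<Prod>A \<le> 5 * \<Prod>C \<and>
    (6 * \<Prod>A = 5 * \<Prod>C \<longrightarrow> 2 \<le> j \<and> n < \<Sum>A + 2 \<and> 2 \<notin> A \<and> 3 \<notin> A \<and>
      insert 3 (insert 2 A) = first_primes (j + 1))"
proof -
  have finA: "finite A" and posA: "\<Prod>A > 0"
    using A(1) prod_prime_set_pos by (auto simp: prime_set_def)
  obtain p where p: "prime p" "p \<notin> A"
    "p \<noteq> 2 \<Longrightarrow> odd p \<and> 3 \<le> p" "\<And>s. prime s \<Longrightarrow> p \<noteq> 2 \<Longrightarrow> s < p + 2 \<Longrightarrow> s \<in> insert p A"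
    using obtain_least_missing_prime[OF A(1)] by metis
  define B where "B = insert p A"
  have B: "prime_set B" "card B = j" "\<Sum>B = p + \<Sum>A" "\<Prod>B = p * \<Prod>A"
    using A p(1,2) finA by (auto simp: B_def prime_set_def)
  show ?thesis
  proof (cases "\<Sum>B \<le> n")
    case True
    have "2 * \<Prod>A \<le> \<Prod>B" unfolding B(4) using prime_ge_2_nat[OF p(1)] by simp
    then show ?thesis using B(1,2) True posA by (intro exI[of _ B]) auto
  next
    case False
    then have nB: "n < \<Sum>B" by simp
    show ?thesis
    proof (cases "p = 2")
      case False
      note p3 = p(3)[OF False]
      obtain C where C: "prime_set C" "card C = j" "\<Sum>C \<le> n"
        "real (\<Prod>B) \<le> 5 / 3 * \<Prod>C * exp ((real (\<Sum>B) - (n + 1)) / (p + 2))"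
        using lower_prime_set[OF B(1), of "p + 2" n] p(4) False nB B(2) A(4) p3 unfolding B_def by auto
      \<comment> \<open>A fits into n, so the sum of B exceeds n + 1 by at most p - 1.\<close>
      have "exp ((real (\<Sum>B) - (n + 1)) / (p + 2)) \<le> exp ((real p - 1) / (p + 2))"
        unfolding B(3) using A(3) by (auto intro!: divide_right_mono simp del: of_nat_sum)
      also have "\<dots> < p / 2"
      \<comment> \<open>The estimate exp x \<le> 1 / (1 - x) yields (p + 2) / 3, which is below p /
        2 only for p > 4. For p = 3 it would give 5/3 instead of 3/2.\<close>
      proof (cases "p = 3")
        case True
        have "exp (2 / 5 :: real) ^ 5 = exp 1 ^ 2"
          using exp_of_nat_mult[of 5 "2/5 :: real"] exp_of_nat_mult[of 2 "1 :: real"] by simp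
        also have "\<dots> \<le> (343 / 125)\<^sup>2" by (rule power_mono[OF exp_1_le]) simp
        also have "\<dots> < (3 / 2) ^ 5" by (simp add: power_divide)
        finally have "exp (2 / 5 :: real) < 3 / 2" by (rule power_less_imp_less_base) simp
        then show ?thesis using True by simp
      next
        case False
        then have p5: "p \<ge> 5" using p3 by presburger
        have "exp ((real p - 1) / (p + 2)) \<le> 1 / (1 - (real p - 1) / (p + 2))"
          by (rule exp_le_inverse) simp
        also have "\<dots> = (p + 2) / 3" by (simp add: field_simps)
        also have "\<dots> < p / 2" using p5 by simp
        finally show ?thesis .
      qed
      finally have "5 / 3 * \<Prod>C * exp ((real (\<Sum>B) - (n + 1)) / (p + 2)) < 5 / 3 * \<Prod>C * (p / 2)"
        using prod_prime_set_pos[OF C(1)] by (intro mult_strict_left_mono) (auto simp del: of_nat_prod)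
      then have "real p * \<Prod>A < real p * (5 / 6 * \<Prod>C)"
        using C(4) unfolding B(4) by simp
      then have "real (6 * \<Prod>A) < real (5 * \<Prod>C)"
        using p3 by simp
      then have "6 * \<Prod>A < 5 * \<Prod>C" unfolding of_nat_less_iff .
      then show ?thesis using C by (intro exI[of _ C]) auto
    next
      case True
      \<comment> \<open>One replacement suffices: r and q are odd, so it saves at least the 2 that
        was added.\<close>
      have lower: "\<exists>C. prime_set C \<and> card C = j \<and> \<Sum>C \<le> n \<and> \<Prod>C * q = 2 * \<Prod>A * r"
        if qr: "q \<in> B" "r \<notin> B" "prime r" "r < q" "prime q" for q r
      proof -
        note C = lower_prime[OF B(1) qr(1-4)]
        have "r > 2" using qr(2,3) True prime_ge_2_nat[of r] by (cases "r = 2") (auto simp: B_def)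
        then have "r + 2 \<le> q" using two_le_odd_primes_diff qr by blast
        then have "\<Sum>(insert r (B - {q})) \<le> n" using C(3) B(3) A(3) True by linarith
        then show ?thesis using C B True by (intro exI[of _ "insert r (B - {q})"]) auto
      qed
      have neqB: "B \<noteq> first_primes (card B)"
        using nB A(4) B(2) sum_first_primes[of j] by (metis not_le)
      \<comment> \<open>Adding 3 forces r \<ge> 5 in any available replacement, which makes the
        inequality strict. No such replacement exists only if D is an initial segment, that is, A
        consists of the first j + 1 primes except 2 and 3.\<close>
      define D where "D = insert 3 B"
      have D: "prime_set D" using B(1) by (auto simp: D_def prime_set_def)
      have gt2: "2 < r" if "r \<notin> B" "prime r" for r
        using that True prime_ge_2_nat[of r] by (cases "r = 2") (auto simp: B_def)
      show ?thesis
      proof (cases "D = first_primes (card D)")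
        case False
        then obtain q r where qr: "q \<in> D" "r \<notin> D" "prime r" "prime q" "r < q"
          and consec: "\<And>s. prime s \<Longrightarrow> r < s \<Longrightarrow> q \<le> s"
          using obtain_consecutive_primes[OF D] by metis
        have r5: "r \<ge> 5"
        proof -
          have "odd r" "r > 2" "r \<noteq> 3" using qr(2,3) gt2[of r] prime_odd_nat[of r] by (auto simp: D_def)
          then show ?thesis by presburger
        qed
        then have "q \<in> B" "r \<notin> B" using qr by (auto simp: D_def)
        then obtain C where C: "prime_set C" "card C = j" "\<Sum>C \<le> n" "\<Prod>C * q = 2 * \<Prod>A * r"
          using lower qr by blast
        have "3 * q < 5 * r" using consecutive_primes_ratio(2)[OF qr(3) _ consec] r5 by simp
        then have "\<Prod>A * (2 * (3 * q)) < \<Prod>A * (2 * (5 * r))" using posA by simp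
        moreover have "(5 * \<Prod>C) * q = \<Prod>A * (2 * (5 * r))" unfolding mult.assoc C(4) by simp
        moreover have "(6 * \<Prod>A) * q = \<Prod>A * (2 * (3 * q))" by simp
        ultimately have "(6 * \<Prod>A) * q < (5 * \<Prod>C) * q" by linarith
        then have "6 * \<Prod>A < 5 * \<Prod>C" by simp
        then show ?thesis using C by (intro exI[of _ C]) auto
      next
        case firstD: True
        have 3: "3 \<notin> B"
        proof
          assume "3 \<in> B"
          then have "D = B" unfolding D_def by blast
          then show False using firstD neqB by blast
        qed
        then have "card D = j + 1" using B(1,2) by (simp add: D_def prime_set_def)
        then have D': "insert 3 (insert 2 A) = first_primes (j + 1)" "3 \<notin> A"
          using firstD 3 True unfolding D_def B_def by auto
        obtain q r where qr: "q \<in> B" "r \<notin> B" "prime r" "prime q" "r < q"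
          and consec: "\<And>s. prime s \<Longrightarrow> r < s \<Longrightarrow> q \<le> s"
          using obtain_consecutive_primes[OF B(1) neqB] by metis
        obtain C where C: "prime_set C" "card C = j" "\<Sum>C \<le> n" "\<Prod>C * q = 2 * \<Prod>A * r"
          using lower qr by blast
        have "q \<in> A" using qr(1,5) gt2[OF qr(2,3)] True by (auto simp: B_def)
        then have "card A > 0" using finA card_gt_0_iff by blast
        then have "2 \<le> j" using A(2) by simp
        have "3 * q \<le> 5 * r"
          using consecutive_primes_ratio(1)[OF qr(3) _ consec] gt2[OF qr(2,3)] by simp
        then have "\<Prod>A * (2 * (3 * q)) \<le> \<Prod>A * (2 * (5 * r))" by simp
        moreover have "(5 * \<Prod>C) * q = \<Prod>A * (2 * (5 * r))" unfolding mult.assoc C(4) by simp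
        moreover have "(6 * \<Prod>A) * q = \<Prod>A * (2 * (3 * q))" by simp
        ultimately have "(6 * \<Prod>A) * q \<le> (5 * \<Prod>C) * q" by linarith
        then have "6 * \<Prod>A \<le> 5 * \<Prod>C" using qr(5) by simp
        then show ?thesis
          using C \<open>2 \<le> j\<close> D' nB B(3) True p(2) by (intro exI[of _ C]) auto
      qed
    qed
  qed
qed

text \<open>The upper bound for \<open>h j n\<close> in the converse. Adjoining the least missing
  prime p must raise the sum to at least \<open>sigma (Suc (card B))\<close>, so p \<ge> 5; lowering
  to the first primes then costs at most exp ((p - 4) / (p + 2)), to be compared with p / 5.\<close>

lemma prod_le_of_sum_le:
  assumes B: "prime_set B" "\<Sum>B + 4 \<le> sigma (Suc (card B))"
  shows "5 * \<Prod>B \<le> \<Prod>(first_primes (Suc (card B)))"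
proof -
  let ?j = "Suc (card B)"
  let ?P = "\<Prod>(first_primes ?j)"
  have finB: "finite B" using B(1) by (auto simp: prime_set_def)
  obtain p where p: "prime p" "p \<notin> B" "p \<noteq> 2 \<Longrightarrow> odd p \<and> 3 \<le> p"
    "\<And>s. prime s \<Longrightarrow> p \<noteq> 2 \<Longrightarrow> s < p + 2 \<Longrightarrow> s \<in> insert p B"
    using obtain_least_missing_prime[OF B(1)] by metis
  define E where "E = insert p B"
  have E: "prime_set E" "card E = ?j" "\<Sum>E = p + \<Sum>B" "\<Prod>E = p * \<Prod>B"
    using B p(1,2) finB by (auto simp: E_def prime_set_def)
  have "sigma ?j \<le> \<Sum>E" using sigma_le_sum_prime_set[OF E(1)] E(2) by simp
  then have "p \<ge> 4" using B(2) E(3) by linarith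
  then have "p \<noteq> 2" "odd p" using p(3) by auto
  have "real (\<Prod>E) \<le> ?P * exp ((real (\<Sum>E) - sigma ?j) / (p + 2))"
    using prod_le_first_primes[OF E(1), of "p + 2"] p(4) \<open>p \<noteq> 2\<close> E(2) unfolding E_def by auto
  also have "\<dots> \<le> ?P * exp ((real p - 4) / (p + 2))"
    unfolding E(3) using B(2)
    by (intro mult_left_mono) (auto intro!: divide_right_mono simp del: of_nat_sum of_nat_prod)
  finally have bound: "p * real (\<Prod>B) \<le> ?P * exp ((real p - 4) / (p + 2))"
    unfolding E(4) by (simp only: of_nat_mult)
  have "p \<noteq> 9" using p(1) by auto
  then have "p = 5 \<or> p = 7 \<or> p \<ge> 10"
    using \<open>p \<ge> 4\<close> \<open>odd p\<close> by presburger
  then consider "p = 5" | "p = 7" | "p \<ge> 10" by blast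
  then show ?thesis
  proof cases
    \<comment> \<open>For p = 5 there is no room for any loss. But the sum of E exceeds its minimum
      by at most 1, while a replacement saves at least 2, so E is already the set of first
      primes.\<close>
    case 1
    have "E = first_primes (card E)"
    proof (rule ccontr)
      assume "E \<noteq> first_primes (card E)"
      then obtain q r where qr: "q \<in> E" "r \<notin> E" "prime r" "prime q" "r < q"
        using obtain_consecutive_primes[OF E(1)] by metis
      have "\<not> r < p + 2" using p(4)[OF qr(3) \<open>p \<noteq> 2\<close>] qr(2) unfolding E_def by blast
      then have "r \<ge> 7" using 1 by simp
      then have "r + 2 \<le> q" using two_le_odd_primes_diff qr by simp
      moreover note C = lower_prime[OF E(1) qr(1,2,3,5)]
      ultimately show False
        using sigma_le_sum_prime_set[OF C(1)] C(2,3) E(2,3) B(2) 1 by simp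
    qed
    then show ?thesis using E(4) 1 unfolding E(2) by (simp only: mult.commute)
  next
    case 2
    \<comment> \<open>The bound (p + 2) / 6 used for p \<ge> 10 would give 3/2 here, more than
      7/5.\<close>
    have "exp (1 / 3 :: real) ^ 3 = exp 1"
      using exp_of_nat_mult[of 3 "1 / 3 :: real"] by simp
    also have "\<dots> \<le> (7 / 5) ^ 3" using exp_1_le by (simp add: power_divide)
    finally have "exp (1 / 3 :: real) \<le> 7 / 5" by (subst (asm) power_mono_iff) auto
    then have "?P * exp (1 / 3) \<le> ?P * (7 / 5)"
      by (rule mult_left_mono[OF _ of_nat_0_le_iff])
    then have "real (5 * \<Prod>B) \<le> real ?P" using bound 2 by simp
    then show ?thesis unfolding of_nat_le_iff .
  next
    case 3
    have "exp ((real p - 4) / (p + 2)) \<le> 1 / (1 - (real p - 4) / (p + 2))"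
      by (rule exp_le_inverse) simp
    also have "\<dots> = (p + 2) / 6" by (simp add: field_simps)
    also have "\<dots> \<le> p / 5" using 3 by simp
    finally have "?P * exp ((real p - 4) / (p + 2)) \<le> ?P * (p / 5)"
      by (rule mult_left_mono[OF _ of_nat_0_le_iff])
    with bound have "p * real (\<Prod>B) \<le> real ?P * (p / 5)" by (rule order_trans)
    then have "real p * (5 * \<Prod>B) \<le> real p * ?P" by (simp add: mult.commute)
    then have "real (5 * \<Prod>B) \<le> real ?P" using 3 by simp
    then show ?thesis unfolding of_nat_le_iff .
  qed
qed

section \<open>From sets of primes back to \<open>h\<close>\<close>

lemma h_prime_set:
  assumes "sigma j \<le> n"
  obtains A where "prime_set A" "card A = j" "\<Sum>A \<le> n" "h j n = \<Prod>A"
proof -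
  let ?A = "prime_factors (h j n)"
  have M: "h j n > 0" "squarefree (h j n)" "card ?A = j" "\<Sum>?A \<le> n"
    using h_spec(1)[OF assms] by (auto simp: candidates_def omega_def ell_def)
  have "h j n = (\<Prod>p\<in>?A. p ^ multiplicity p (h j n))"
    using M(1) prime_factorization_nat by auto
  also have "\<dots> = \<Prod>?A"
    using squarefree_factorial_semiring'[of "h j n"] M by (intro prod.cong) auto
  finally show thesis using that[of ?A] M by (auto simp: prime_set_def)
qed

lemma prod_le_h:
  assumes "prime_set A" "\<Sum>A \<le> n"
  shows "\<Prod>A \<le> h (card A) n"
proof -
  have "squarefree (\<Prod>A)" "prime_factors (\<Prod>A) = A"
    using squarefree_prod_primes[of A] assms(1) by (auto simp: prime_set_def)
  then have "\<Prod>A \<in> candidates (card A) n"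
    using assms prod_prime_set_pos[OF assms(1)] by (simp add: candidates_def omega_def ell_def)
  moreover have "sigma (card A) \<le> n" using sigma_le_sum_prime_set[OF assms(1)] assms(2) by simp
  ultimately show ?thesis using h_spec(2) by blast
qed

theorem theorem6p1:
  fixes n j :: nat
  assumes "n \<ge> 2" and "1 \<le> j" and "j \<le> kmax n"
  shows "real (h (j - 1) n) \<le> 5 / 6 * real (h j n) \<and>
    (real (h (j - 1) n) = 5 / 6 * real (h j n) \<longleftrightarrow>
      j = kmax n \<and> kmax n \<ge> 2 \<and>
      (int n = int (sigma (j + 1)) - 4 \<or> int n = int (sigma (j + 1)) - 5))"
proof -
  have mono: "sigma a \<le> sigma b" if "a \<le> b" for a b
    using strict_mono_sigma that by (simp add: strict_mono_less_eq)
  have sj: "sigma j \<le> n" using mono[OF assms(3)] kmax_spec(1)[of n] by simp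
  then have sj1: "sigma (j - 1) \<le> n" using mono[of "j - 1" j] by simp
  obtain A where A: "prime_set A" "card A = j - 1" "\<Sum>A \<le> n" "h (j - 1) n = \<Prod>A"
    using h_prime_set[OF sj1] by blast
  obtain C where C: "prime_set C" "card C = j" "\<Sum>C \<le> n" "6 * \<Prod>A \<le> 5 * \<Prod>C"
    and eq: "6 * \<Prod>A = 5 * \<Prod>C \<Longrightarrow> 2 \<le> j \<and> n < \<Sum>A + 2 \<and> 2 \<notin> A \<and> 3 \<notin> A \<and>
      insert 3 (insert 2 A) = first_primes (j + 1)"
    using add_prime_factor[OF A(1) _ A(3) sj] A(2) assms(2) by auto
  have hC: "\<Prod>C \<le> h j n" using prod_le_h[OF C(1,3)] C(2) by simp
  have le: "6 * h (j - 1) n \<le> 5 * h j n" using C(4) A(4) hC by linarith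
  have "6 * h (j - 1) n = 5 * h j n \<longleftrightarrow> j = kmax n \<and> kmax n \<ge> 2 \<and>
    (n + 4 = sigma (j + 1) \<or> n + 5 = sigma (j + 1))" (is "?L \<longleftrightarrow> ?R")
  proof
    assume ?L
    \<comment> \<open>The product of C lies between 6/5 of the product of A and
      \<open>h j n\<close>, so equality at the ends forces it here.\<close>
    then have "6 * \<Prod>A = 5 * \<Prod>C" using C(4) A(4) hC by linarith
    note eq = eq[OF this]
    have "\<Sum>A + 5 = sigma (j + 1)"
    proof -
      have "\<Sum>(insert 3 (insert 2 A)) = sigma (j + 1)"
        using eq sum_first_primes[of "j + 1"] by metis
      moreover have "finite A" "2 \<notin> A" "3 \<notin> A" using A(1) eq by (auto simp: prime_set_def)
      ultimately show ?thesis by simp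
    qed
    then have n: "n + 4 = sigma (j + 1) \<or> n + 5 = sigma (j + 1)" using eq A(3) by linarith
    then have "sigma (kmax n) < sigma (j + 1)" using kmax_spec(1)[of n] by linarith
    then have "kmax n < j + 1" using strict_mono_less[OF strict_mono_sigma] by blast
    then show ?R using n eq assms(3) by auto
  next
    assume R: ?R
    let ?F = "first_primes (j + 1)"
    have F: "prime_set ?F" by (rule prime_set_first_primes)
    have "nth_prime 2 = 3"
    proof -
      have "nth_prime 2 = (LEAST q. prime q \<and> 2 < q)"
        using nth_prime_Suc[of 1] nth_prime_1 by (simp add: numeral_2_eq_2)
      also have "\<dots> = 3" by (rule Least_equality) auto
      finally show ?thesis .
    qed
    then have 23: "2 \<in> ?F" "3 \<in> ?F"
      using R nth_prime_1 unfolding first_primes_def by (force intro: rev_image_eqI)+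
    \<comment> \<open>The extremal set: its sum is \<open>sigma (j + 1)\<close> - 5 and its product
      a sixth of that of \<open>?F\<close>. With \<open>prod_le_of_sum_le\<close> this squeezes the
      product of \<open>?F\<close> between 5 \<open>h j n\<close> and 6
      \<open>h (j - 1) n\<close>.\<close>
    define G where "G = ?F - {2, 3}"
    have G: "prime_set G" using F by (auto simp: prime_set_def G_def)
    have F23: "?F = insert 2 (insert 3 G)" "2 \<notin> insert 3 G" "3 \<notin> G"
      using 23 by (auto simp: G_def)
    have fin: "finite G" using G by (simp add: prime_set_def)
    have G': "card G + 2 = j + 1" "\<Sum>G + 5 = sigma (j + 1)" "6 * \<Prod>G = \<Prod>?F"
      using card_first_primes[of "j + 1"] sum_first_primes[of "j + 1"] fin F23(2,3)
      unfolding F23(1) by simp_all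
    have "card G = j - 1" "\<Sum>G \<le> n" using G'(1,2) R by linarith+
    then have "\<Prod>?F \<le> 6 * h (j - 1) n"
      using prod_le_h[OF G, of n] G'(3) by simp
    moreover obtain B where B: "prime_set B" "card B = j" "\<Sum>B \<le> n" "h j n = \<Prod>B"
      using h_prime_set[OF sj] by blast
    then have "5 * h j n \<le> \<Prod>?F"
      using prod_le_of_sum_le[OF B(1)] R by auto
    ultimately show ?L using le by linarith
  qed
  moreover have "int n = int (sigma (j + 1)) - 4 \<longleftrightarrow> n + 4 = sigma (j + 1)"
    "int n = int (sigma (j + 1)) - 5 \<longleftrightarrow> n + 5 = sigma (j + 1)"
    by linarith+
  moreover have "real (h (j - 1) n) \<le> 5 / 6 * real (h j n) \<longleftrightarrow> 6 * h (j - 1) n \<le> 5 * h j n"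
    "real (h (j - 1) n) = 5 / 6 * real (h j n) \<longleftrightarrow> 6 * h (j - 1) n = 5 * h j n"
    by linarith+
  ultimately show ?thesis using le by simp
qed

end
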